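(* Let $k\ge 2$ and $a\ge 0$ be integers. Let $B_{k,a}$ be the set of vertices of $\{1\}\times\mathcal{P}_{k,a}$, and let $A_{k,a}:=\{(k,\mathbf{1},t): t\in\mathbb{Z},\ k+1\le t\le a-1\}\subset\mathbb{Z}\times\mathbb{Z}^{2k}\times\mathbb{Z}$, where $\mathbf{1}=(1,\dots,1)\in\mathbb{Z}^{2k}$ (so $A_{k,a}$ is empty if $a\le k+1$). Then $B_{k,a}\cup A_{k,a}$ is the Hilbert basis of $\mathcal{C}_{k,a}$.
   Context: Let $C_{2k}$ be the cycle with vertices $1,\dots,2k$ in cyclic order and edges $(i,i+1)$, $i=1,\dots,2k$, where $(2k,2k+1)$ means $(2k,1)$. For an edge $e$ let $V(e)\in\mathbb{Z}^{2k}$ be the vector with coordinates $V(e)_v=1$ if $v\in e$ and $V(e)_v=0$ otherwise. The polytope $\mathcal{P}_{k,a}$ is the convex hull in $\mathbb{Z}^{2k}\times\mathbb{Z}$ (tensored with the reals) of the points $(V(i,i+1),0)$, $(V(i,i+1),1)$ for $i=2,3,\dots,2k$, together with $(V(1,2),a)$ and $(V(1,2),a+1)$. $\mathcal{C}_{k,a}\subset\mathbb{Z}\times\mathbb{Z}^{2k}\times\mathbb{Z}$ denotes the semigroup of lattice points in the real cone over $\{1\}\times\mathcal{P}_{k,a}$. Its Hilbert basis is its minimum set of generators as a semigroup. *)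

theory Defs
  imports "HOL-Analysis.Analysis" "HOL-Analysis.Finite_Function_Topology"
begin

text \<open>The number of coordinates depends on the variable \<open>k\<close>, so the real vector space with
  coordinates \<open>1, \<dots>, 2k\<close> is modelled as the subspace of all \<open>x :: nat \<Rightarrow>\<^sub>0 real\<close> supported on
  \<open>{1..2*k}\<close>. Points of the polytope live in \<open>(nat \<Rightarrow>\<^sub>0 real) \<times> real\<close>, and points of the cone
  in \<open>real \<times> (nat \<Rightarrow>\<^sub>0 real) \<times> real\<close>.\<close>

text \<open>Only meaningful for finite \<open>S\<close>, since values of type \<open>nat \<Rightarrow>\<^sub>0 real\<close> have finite support.\<close>

definition ind_vec :: "nat set \<Rightarrow> (nat \<Rightarrow>\<^sub>0 real)" where
  "ind_vec S = Abs_poly_mapping (\<lambda>v. if v \<in> S then 1 else 0)"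

lemma lookup_ind_vec:
  assumes "finite S"
  shows "Poly_Mapping.lookup (ind_vec S) v = (if v \<in> S then 1 else 0)"
proof -
  have "finite {v. (if v \<in> S then 1 else 0 :: real) \<noteq> 0}"
    using assms by simp
  then show ?thesis
    unfolding ind_vec_def by simp
qed

definition cycle_edge :: "nat \<Rightarrow> nat \<Rightarrow> nat set" where
  "cycle_edge k i = {i, if i = 2 * k then 1 else i + 1}"

definition polytope_P :: "nat \<Rightarrow> int \<Rightarrow> ((nat \<Rightarrow>\<^sub>0 real) \<times> real) set" where
  "polytope_P k a = convex hull
     ((\<Union>i\<in>{2..2 * k}. {(ind_vec (cycle_edge k i), 0), (ind_vec (cycle_edge k i), 1)})
      \<union> {(ind_vec (cycle_edge k 1), real_of_int a), (ind_vec (cycle_edge k 1), real_of_int (a + 1))})"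

definition lattice_points :: "nat \<Rightarrow> (real \<times> (nat \<Rightarrow>\<^sub>0 real) \<times> real) set" where
  "lattice_points k = {(h, x, t). h \<in> \<int> \<and> Poly_Mapping.keys x \<subseteq> {1..2 * k} \<and>
     (\<forall>v. Poly_Mapping.lookup x v \<in> \<int>) \<and> t \<in> \<int>}"

definition semigroup_C :: "nat \<Rightarrow> int \<Rightarrow> (real \<times> (nat \<Rightarrow>\<^sub>0 real) \<times> real) set" where
  "semigroup_C k a = cone hull ({1} \<times> polytope_P k a) \<inter> lattice_points k"

definition add_submonoid :: "'a::comm_monoid_add set \<Rightarrow> bool" where
  "add_submonoid M \<longleftrightarrow> 0 \<in> M \<and> (\<forall>x\<in>M. \<forall>y\<in>M. x + y \<in> M)"

text \<open>As usual for affine semigroups (which contain \<open>0\<close>), generation allows the empty sum, so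
  \<open>0\<close> itself never needs to be a generator. Minimum means least with respect to inclusion.\<close>

definition is_hilbert_basis :: "'a::comm_monoid_add set \<Rightarrow> 'a set \<Rightarrow> bool" where
  "is_hilbert_basis M H \<longleftrightarrow>
     add_submonoid hull H = M \<and> (\<forall>G. add_submonoid hull G = M \<longrightarrow> H \<subseteq> G)"

definition set_B :: "nat \<Rightarrow> int \<Rightarrow> (real \<times> (nat \<Rightarrow>\<^sub>0 real) \<times> real) set" where
  "set_B k a = {p. p extreme_point_of ({1} \<times> polytope_P k a)}"

definition set_A :: "nat \<Rightarrow> int \<Rightarrow> (real \<times> (nat \<Rightarrow>\<^sub>0 real) \<times> real) set" where
  "set_A k a = {(real k, ind_vec {1..2 * k}, real_of_int t) | t. int k + 1 \<le> t \<and> t \<le> a - 1}"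

end

theory Submission
  imports Defs
begin

text \<open>A point of the cone is a nonnegative weight \<open>w\<close> on the edges of the cycle together with a last
  coordinate \<open>t\<close>: it is \<open>(h, x, t)\<close>, where \<open>h\<close> is the total weight, \<open>x\<close> the weighted sum of the edge
  vectors, and \<open>t\<close> ranges over the interval from \<open>a w\<^sub>1\<close> to \<open>a w\<^sub>1 + h\<close> (lemma
  \<open>cone_hull_prism\<close>). A weight is not determined by \<open>x\<close>, because the cycle is even: alternately
  adding and subtracting a constant along the cycle leaves \<open>x\<close> unchanged, but it moves the interval.

  Suppose \<open>x\<close> is integral. Neighbouring weights then have integral sums. Hence either all weights
  are integers, or the fractional parts alternate between some \<open>\<delta>\<close> and \<open>1 - \<delta>\<close>, so that they sum to
  \<open>k\<close> and contribute exactly the all-ones vector (lemma \<open>weights_floor_plus_alternating\<close>).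

  Generation. A lattice point with integral weights is peeled off into vertices one edge at a time
  (\<open>integral_weights_generated\<close>). Otherwise the floors of the weights carry a point with integral
  weights and height \<open>h - k\<close>, and the rest has the form \<open>(k, 1, t)\<close>. Since \<open>w\<^sub>1\<close> lies between its
  floor and the next integer and \<open>a \<ge> 0\<close>, the last coordinate can be split such that
  \<open>0 \<le> t \<le> a + k\<close> in the rest.
  If \<open>t \<le> k\<close> the rest comes from weight one on the even edges, if \<open>t \<ge> a\<close> from weight one on
  the odd edges, and the values strictly between are the elements of \<open>A\<close>
  (\<open>all_ones_generated\<close>).

  Minimality. In any generating set every irreducible element must occur. A vertex has height one and
  the only element of height zero is \<open>0\<close>, so vertices are irreducible. If an element of \<open>A\<close> is a sum
  of two nonzero elements, both have height less than \<open>k\<close>, which leaves no room for alternating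
  fractional parts. So both have integral weights, the total weight of the first edge is
  \<open>0\<close> or \<open>1\<close>, and then the last coordinate is at most \<open>k\<close> or at least \<open>a\<close>, which is excluded
  in \<open>A\<close> (\<open>set_A_irreducible\<close>).\<close>

section \<open>Generating sets and irreducible elements\<close>

lemma add_submonoid_hull: "add_submonoid (add_submonoid hull G)"
  by (rule hull_in) (auto simp: add_submonoid_def)

lemma add_submonoid_sum:
  assumes "add_submonoid M" and "\<And>i. i \<in> I \<Longrightarrow> f i \<in> M"
  shows "sum f I \<in> M"
  using assms(2) by (induction I rule: infinite_finite_induct)
    (use assms(1) in \<open>auto simp: add_submonoid_def\<close>)

text \<open>Irreducibility says precisely that removing \<open>p\<close> from \<open>M\<close> leaves a submonoid, which would contain
  any generating set that misses \<open>p\<close>.\<close>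

lemma irreducible_in_generating_set:
  assumes gen: "add_submonoid hull G = M" and "p \<in> M" and "p \<noteq> 0"
    and irr: "\<And>x y. x \<in> M \<Longrightarrow> y \<in> M \<Longrightarrow> x + y = p \<Longrightarrow> x = 0 \<or> y = 0"
  shows "p \<in> G"
proof (rule ccontr)
  assume "p \<notin> G"
  have M: "add_submonoid M"
    using add_submonoid_hull[of G] gen by simp
  have "add_submonoid (M - {p})"
    unfolding add_submonoid_def
  proof (intro conjI ballI)
    show "0 \<in> M - {p}"
      using M \<open>p \<noteq> 0\<close> by (auto simp: add_submonoid_def)
    fix x y assume xy: "x \<in> M - {p}" "y \<in> M - {p}"
    have "x + y \<noteq> p"
      using irr[of x y] xy by auto
    then show "x + y \<in> M - {p}"
      using M xy by (auto simp: add_submonoid_def)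
  qed
  moreover have "G \<subseteq> M - {p}"
    using hull_subset[of G add_submonoid] gen \<open>p \<notin> G\<close> by auto
  ultimately have "M \<subseteq> M - {p}"
    using hull_minimal[of G "M - {p}" add_submonoid] gen by simp
  with \<open>p \<in> M\<close> show False by auto
qed

section \<open>Edge weights on the even cycle\<close>

lemma lookup_scaleR:
  fixes x :: "'a \<Rightarrow>\<^sub>0 'b::real_vector"
  shows "Poly_Mapping.lookup (c *\<^sub>R x) v = c *\<^sub>R Poly_Mapping.lookup x v"
proof -
  have "finite {i. c *\<^sub>R Poly_Mapping.lookup x i \<noteq> 0}"
    by (rule finite_subset[OF _ finite_lookup[of x]]) auto
  then show ?thesis
    by (simp add: scaleR_poly_mapping_def)
qed

definition edge_combination :: "nat \<Rightarrow> (nat \<Rightarrow> real) \<Rightarrow> (nat \<Rightarrow>\<^sub>0 real)" where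
  "edge_combination k w = (\<Sum>i\<in>{1..2 * k}. w i *\<^sub>R ind_vec (cycle_edge k i))"

lemma edge_combination_add:
  "edge_combination k (\<lambda>i. w i + w' i) = edge_combination k w + edge_combination k w'"
  by (simp add: edge_combination_def sum.distrib scaleR_add_left)

lemma edge_combination_scaleR:
  "edge_combination k (\<lambda>i. c * w i) = c *\<^sub>R edge_combination k w"
  by (simp add: edge_combination_def scaleR_sum_right)

lemma edge_combination_cong:
  "(\<And>i. i \<in> {1..2 * k} \<Longrightarrow> w i = w' i) \<Longrightarrow> edge_combination k w = edge_combination k w'"
  unfolding edge_combination_def by (rule sum.cong) auto

lemma edge_combination_single:
  assumes "e \<in> {1..2 * k}"
  shows "edge_combination k (\<lambda>i. if i = e then c else 0) = c *\<^sub>R ind_vec (cycle_edge k e)"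
  using assms by (simp add: edge_combination_def if_distrib[of "\<lambda>c. c *\<^sub>R _"] cong: if_cong)

text \<open>Vertex \<open>v\<close> lies on exactly two edges, the one that starts in \<open>v\<close> and its cyclic predecessor.\<close>

lemma lookup_edge_combination:
  assumes "v \<in> {1..2 * k}"
  shows "Poly_Mapping.lookup (edge_combination k w) v = w v + w (if v = 1 then 2 * k else v - 1)"
proof -
  let ?p = "if v = 1 then 2 * k else v - 1"
  have p: "?p \<in> {1..2 * k}" "?p \<noteq> v"
    using assms by auto
  have mem: "v \<in> cycle_edge k i \<longleftrightarrow> i = v \<or> i = ?p" if "i \<in> {1..2 * k}" for i
    using that assms by (auto simp: cycle_edge_def)
  have "Poly_Mapping.lookup (edge_combination k w) v
      = (\<Sum>i\<in>{1..2 * k}. w i * (if v \<in> cycle_edge k i then 1 else 0))"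
    by (simp add: edge_combination_def lookup_sum lookup_scaleR lookup_ind_vec cycle_edge_def)
  also have "\<dots> = (\<Sum>i\<in>{1..2 * k}. (if i = v then w i else 0) + (if i = ?p then w i else 0))"
    using p by (intro sum.cong) (auto simp: mem)
  also have "\<dots> = w v + w ?p"
    using assms p(1) by (subst sum.distrib) (simp only: sum.delta finite_atLeastAtMost if_True)
  finally show ?thesis .
qed

lemma lookup_edge_combination_outside:
  assumes "v \<notin> {1..2 * k}"
  shows "Poly_Mapping.lookup (edge_combination k w) v = 0"
proof -
  have "v \<notin> cycle_edge k i" if "i \<in> {1..2 * k}" for i
    using that assms by (auto simp: cycle_edge_def split: if_splits)
  then show ?thesis
    by (simp add: edge_combination_def lookup_sum lookup_scaleR lookup_ind_vec cycle_edge_def)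
qed

text \<open>These weights are the fibre of \<open>edge_combination\<close> over the all-ones vector. The values
  \<open>s = 0\<close> and \<open>s = 1\<close> give the two perfect matchings of the cycle.\<close>

definition alternating :: "real \<Rightarrow> nat \<Rightarrow> real" where
  "alternating s i = (if odd i then s else 1 - s)"

lemma sum_alternating: "sum (alternating s) {1..2 * k} = real k"
  by (induction k) (auto simp: alternating_def)

lemma edge_combination_alternating:
  "edge_combination k (alternating s) = ind_vec {1..2 * k}"
proof (rule poly_mapping_eqI)
  fix v
  show "Poly_Mapping.lookup (edge_combination k (alternating s)) v
      = Poly_Mapping.lookup (ind_vec {1..2 * k}) v"
  proof (cases "v \<in> {1..2 * k}")
    case True
    then have "odd (if v = 1 then 2 * k else v - 1) \<longleftrightarrow> even v"
      by auto
    with True show ?thesis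
      by (simp add: lookup_edge_combination lookup_ind_vec alternating_def)
  next
    case False
    then show ?thesis
      by (simp add: lookup_edge_combination_outside lookup_ind_vec del: atLeastAtMost_iff)
  qed
qed

text \<open>The sum of two neighbouring weights is a coordinate of the edge combination. When it is an
  integer, the fractional part of one weight determines that of the next.\<close>

lemma frac_alternating:
  assumes int: "\<And>v. v \<in> {1..2 * k} \<Longrightarrow> Poly_Mapping.lookup (edge_combination k w) v \<in> \<int>"
    and "w 1 \<notin> \<int>" and "i \<in> {1..2 * k}"
  shows "frac (w i) = alternating (frac (w 1)) i"
proof -
  have "1 \<le> i" "i \<le> 2 * k" using assms(3) by auto
  then show ?thesis
  proof (induction i rule: dec_induct)
    case base
    then show ?case by (simp add: alternating_def)
  next
    case (step n)
    then have IH: "frac (w n) = alternating (frac (w 1)) n" by simp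
    have "w (Suc n) + w n \<in> \<int>"
      using int[of "Suc n"] step by (simp add: lookup_edge_combination)
    then obtain m where "w (Suc n) + w n = of_int m"
      by (auto elim: Ints_cases)
    then have eq: "w (Suc n) = - w n + of_int m" by simp
    have "frac (w 1) \<noteq> 0" "frac (w 1) \<noteq> 1"
      using \<open>w 1 \<notin> \<int>\<close> frac_lt_1[of "w 1"] by (auto simp: frac_eq_0_iff)
    then have "frac (w n) \<noteq> 0"
      using IH by (auto simp: alternating_def)
    then have "w n \<notin> \<int>" by (simp add: frac_eq_0_iff)
    then have "frac (w (Suc n)) = 1 - frac (w n)"
      unfolding eq frac_def using floor_add_int[of "- w n" m] frac_neg[of "w n"] by (simp add: frac_def)
    then show ?case
      using IH by (auto simp: alternating_def)
  qed
qed

lemma weights_integral: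
  assumes int: "\<And>v. v \<in> {1..2 * k} \<Longrightarrow> Poly_Mapping.lookup (edge_combination k w) v \<in> \<int>"
    and "w 1 \<in> \<int>" and "i \<in> {1..2 * k}"
  shows "w i \<in> \<int>"
proof -
  have "1 \<le> i" "i \<le> 2 * k" using assms(3) by auto
  then show ?thesis
  proof (induction i rule: dec_induct)
    case base
    then show ?case using assms by simp
  next
    case (step n)
    have "w (Suc n) + w n \<in> \<int>"
      using int[of "Suc n"] step by (simp add: lookup_edge_combination)
    then have "w (Suc n) + w n - w n \<in> \<int>"
      using step by (intro Ints_diff) auto
    then show ?case by simp
  qed
qed

text \<open>The dichotomy behind the whole proof: if integral coordinates do not force integral weights, the
  fractional parts use up height \<open>k\<close> and split off the all-ones vector.\<close>

lemma weights_floor_plus_alternating: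
  assumes int: "\<And>v. v \<in> {1..2 * k} \<Longrightarrow> Poly_Mapping.lookup (edge_combination k w) v \<in> \<int>"
    and nonint: "w 1 \<notin> \<int>"
  shows "sum w {1..2 * k} = (\<Sum>i\<in>{1..2 * k}. of_int \<lfloor>w i\<rfloor>) + real k"
    and "edge_combination k w = edge_combination k (\<lambda>i. of_int \<lfloor>w i\<rfloor>) + ind_vec {1..2 * k}"
proof -
  define f where "f = alternating (frac (w 1))"
  have w: "w i = of_int \<lfloor>w i\<rfloor> + f i" if "i \<in> {1..2 * k}" for i
    using frac_alternating[OF int nonint that] by (simp add: f_def frac_def)
  have "sum w {1..2 * k} = (\<Sum>i\<in>{1..2 * k}. of_int \<lfloor>w i\<rfloor> + f i)"
    by (intro sum.cong refl w)
  then show "sum w {1..2 * k} = (\<Sum>i\<in>{1..2 * k}. of_int \<lfloor>w i\<rfloor>) + real k"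
    unfolding sum.distrib f_def sum_alternating .
  have "edge_combination k w = edge_combination k (\<lambda>i. of_int \<lfloor>w i\<rfloor> + f i)"
    by (intro edge_combination_cong w)
  then show "edge_combination k w = edge_combination k (\<lambda>i. of_int \<lfloor>w i\<rfloor>) + ind_vec {1..2 * k}"
    by (simp add: edge_combination_add f_def edge_combination_alternating)
qed

section \<open>The cone and its vertices in terms of edge weights\<close>

text \<open>Over each edge the polytope has a vertical segment of length one. The parameter \<open>e\<close> is the
  position on it; the endpoints \<open>e = 0\<close> and \<open>e = 1\<close> are the given generators of the polytope.\<close>

definition prism_point :: "nat \<Rightarrow> int \<Rightarrow> nat \<Rightarrow> real \<Rightarrow> real \<times> (nat \<Rightarrow>\<^sub>0 real) \<times> real" where
  "prism_point k a i e = (1, ind_vec (cycle_edge k i), (if i = 1 then of_int a else 0) + e)"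

lemma prism_hull:
  assumes "k \<ge> 1"
  shows "{1} \<times> polytope_P k a = convex hull ((\<lambda>(i, e). prism_point k a i e) ` ({1..2 * k} \<times> {0, 1}))"
proof -
  have "{1::real} \<times> ((\<Union>i\<in>{2..2 * k}. {(ind_vec (cycle_edge k i), 0), (ind_vec (cycle_edge k i), 1)})
      \<union> {(ind_vec (cycle_edge k 1), real_of_int a), (ind_vec (cycle_edge k 1), real_of_int (a + 1))})
    = (\<lambda>(i, e). prism_point k a i e) ` ({1..2 * k} \<times> {0, 1})" (is "?L = ?R")
  proof
    show "?R \<subseteq> ?L"
    proof
      fix p assume "p \<in> ?R"
      then obtain z where z: "z \<in> {1..2 * k} \<times> {0, 1::real}"
        "p = (case z of (i, e) \<Rightarrow> prism_point k a i e)"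
        by blast
      then obtain i e where ie: "p = prism_point k a i e" "i \<in> {1..2 * k}" "e = 0 \<or> e = 1"
        by (cases z) auto
      show "p \<in> ?L"
      proof (cases "i = 1")
        case True
        then show ?thesis using ie(1,3) by (auto simp: prism_point_def)
      next
        case False
        then have "i \<in> {2..2 * k}" using ie(2) by auto
        then show ?thesis using ie(1,3) False by (auto simp: prism_point_def)
      qed
    qed
    show "?L \<subseteq> ?R"
    proof
      fix p assume "p \<in> ?L"
      then obtain y where p: "p = (1, y)" and y: "y \<in> (\<Union>i\<in>{2..2 * k}.
          {(ind_vec (cycle_edge k i), 0), (ind_vec (cycle_edge k i), 1)})
        \<union> {(ind_vec (cycle_edge k 1), real_of_int a), (ind_vec (cycle_edge k 1), real_of_int (a + 1))}"
        by blast
      from y consider i where "i \<in> {2..2 * k}"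
          "y = (ind_vec (cycle_edge k i), 0) \<or> y = (ind_vec (cycle_edge k i), 1)"
        | "y = (ind_vec (cycle_edge k 1), real_of_int a) \<or> y = (ind_vec (cycle_edge k 1), real_of_int (a + 1))"
        by blast
      then have "\<exists>i e. i \<in> {1..2 * k} \<and> e \<in> {0, 1} \<and> p = prism_point k a i e"
      proof cases
        case (1 i)
        then show ?thesis
          by (intro exI[of _ i] exI[of _ "snd y"]) (auto simp: p prism_point_def)
      next
        case 2
        then show ?thesis using assms
          by (intro exI[of _ 1] exI[of _ "snd y - of_int a"]) (auto simp: p prism_point_def)
      qed
      then obtain i e where "i \<in> {1..2 * k}" "e \<in> {0, 1}" "p = prism_point k a i e"
        by blast
      then show "p \<in> ?R"
        by (intro image_eqI[of _ _ "(i, e)"]) simp_all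
    qed
  qed
  moreover have "{1::real} \<times> (convex hull S) = convex hull ({1} \<times> S)"
    for S :: "((nat \<Rightarrow>\<^sub>0 real) \<times> real) set"
    by (simp add: convex_hull_Times)
  ultimately show ?thesis
    unfolding polytope_P_def by (simp only:)
qed

text \<open>An explicit description of the cone. A separate position on the segment over each edge is
  not recorded, since only the sum of these positions matters and it can be any number between \<open>0\<close>
  and the total weight.\<close>

definition weight_cone :: "nat \<Rightarrow> int \<Rightarrow> (real \<times> (nat \<Rightarrow>\<^sub>0 real) \<times> real) set" where
  "weight_cone k a = {(sum w {1..2 * k}, edge_combination k w, t) | w t.
     (\<forall>i\<in>{1..2 * k}. 0 \<le> w i) \<and> of_int a * w 1 \<le> t \<and> t \<le> of_int a * w 1 + sum w {1..2 * k}}"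

lemma convex_cone_weight_cone: "convex (weight_cone k a) \<and> cone (weight_cone k a)"
  unfolding convex_cone
proof (intro conjI ballI allI impI)
  fix p q assume "p \<in> weight_cone k a" "q \<in> weight_cone k a"
  then obtain w t w' t' where w: "p = (sum w {1..2 * k}, edge_combination k w, t)"
      "\<forall>i\<in>{1..2 * k}. 0 \<le> w i" "of_int a * w 1 \<le> t" "t \<le> of_int a * w 1 + sum w {1..2 * k}"
    and w': "q = (sum w' {1..2 * k}, edge_combination k w', t')"
      "\<forall>i\<in>{1..2 * k}. 0 \<le> w' i" "of_int a * w' 1 \<le> t'" "t' \<le> of_int a * w' 1 + sum w' {1..2 * k}"
    unfolding weight_cone_def by auto
  have "p + q = (sum (\<lambda>i. w i + w' i) {1..2 * k}, edge_combination k (\<lambda>i. w i + w' i), t + t')"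
    by (simp add: w(1) w'(1) sum.distrib edge_combination_add)
  then show "p + q \<in> weight_cone k a"
    unfolding weight_cone_def mem_Collect_eq using w w'
    by (intro exI[of _ "\<lambda>i. w i + w' i"] exI[of _ "t + t'"]) (auto simp: sum.distrib distrib_left)
next
  fix p and c :: real assume "p \<in> weight_cone k a" and c: "c \<ge> 0"
  then obtain w t where w: "p = (sum w {1..2 * k}, edge_combination k w, t)"
      "\<forall>i\<in>{1..2 * k}. 0 \<le> w i" "of_int a * w 1 \<le> t" "t \<le> of_int a * w 1 + sum w {1..2 * k}"
    unfolding weight_cone_def by auto
  have "c *\<^sub>R p = (sum (\<lambda>i. c * w i) {1..2 * k}, edge_combination k (\<lambda>i. c * w i), c * t)"
    by (simp add: w(1) edge_combination_scaleR sum_distrib_left)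
  moreover have "of_int a * (c * w 1) \<le> c * t"
      "c * t \<le> of_int a * (c * w 1) + sum (\<lambda>i. c * w i) {1..2 * k}"
    using mult_left_mono[OF w(3) c] mult_left_mono[OF w(4) c]
    by (simp_all add: algebra_simps sum_distrib_left)
  ultimately show "c *\<^sub>R p \<in> weight_cone k a"
    unfolding weight_cone_def mem_Collect_eq using w c
    by (intro exI[of _ "\<lambda>i. c * w i"] exI[of _ "c * t"]) auto
qed

lemma prism_point_in_weight_cone:
  assumes "i \<in> {1..2 * k}" and "e \<in> {0..1}"
  shows "prism_point k a i e \<in> weight_cone k a"
  unfolding weight_cone_def prism_point_def mem_Collect_eq using assms
  by (intro exI[of _ "\<lambda>j. if j = i then 1 else 0"]
      exI[of _ "(if i = 1 then of_int a else 0) + e"]) (auto simp: edge_combination_single)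

lemma prism_subset_weight_cone:
  assumes "k \<ge> 1"
  shows "{1} \<times> polytope_P k a \<subseteq> weight_cone k a"
  unfolding prism_hull[OF assms]
  by (rule hull_minimal)
    (auto simp: convex_cone_weight_cone intro!: prism_point_in_weight_cone)

lemma prism_point_in_prism:
  assumes "k \<ge> 1" and "i \<in> {1..2 * k}" and "e \<in> {0..1}"
  shows "prism_point k a i e \<in> {1} \<times> polytope_P k a"
proof -
  have *: "prism_point k a i d \<in> {1} \<times> polytope_P k a" if "d \<in> {0, 1}" for d
    unfolding prism_hull[OF assms(1)] using assms(2) that by (intro hull_inc) (auto simp: image_iff)
  have "convex ({1::real} \<times> polytope_P k a)"
    unfolding prism_hull[OF assms(1)] by (rule convex_convex_hull)
  from convexD[OF this *[of 0] *[of 1], of "1 - e" e]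
  have "(1 - e) *\<^sub>R prism_point k a i 0 + e *\<^sub>R prism_point k a i 1 \<in> {1} \<times> polytope_P k a"
    using assms(3) by simp
  moreover have "(1 - e) *\<^sub>R prism_point k a i 0 + e *\<^sub>R prism_point k a i 1 = prism_point k a i e"
    by (simp add: prism_point_def algebra_simps flip: scaleR_add_left)
  ultimately show ?thesis by simp
qed

text \<open>For the inclusion from right to left, all edges can be given the same relative position
  \<open>e\<close> on their segments, namely the one that produces the prescribed last coordinate.\<close>

lemma cone_hull_prism:
  assumes "k \<ge> 1"
  shows "cone hull ({1} \<times> polytope_P k a) = weight_cone k a"
proof
  show "cone hull ({1} \<times> polytope_P k a) \<subseteq> weight_cone k a"
    using prism_subset_weight_cone[OF assms] convex_cone_weight_cone by (intro hull_minimal) auto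
next
  let ?C = "cone hull ({1::real} \<times> polytope_P k a)"
  have "convex ({1::real} \<times> polytope_P k a)"
    unfolding prism_hull[OF assms] by (rule convex_convex_hull)
  then have "convex ?C \<and> cone ?C"
    by (intro conjI convex_cone_hull cone_cone_hull)
  then have add: "\<And>x y. x \<in> ?C \<Longrightarrow> y \<in> ?C \<Longrightarrow> x + y \<in> ?C"
    and scale: "\<And>x c. x \<in> ?C \<Longrightarrow> c \<ge> 0 \<Longrightarrow> c *\<^sub>R x \<in> ?C"
    unfolding convex_cone by blast+
  have sub: "{1} \<times> polytope_P k a \<subseteq> ?C" by (rule hull_subset)
  have "prism_point k a 1 0 \<in> ?C"
    using prism_point_in_prism[OF assms, of 1 0 a] assms sub by auto
  then have "0 \<in> ?C"
    using scale[of _ 0] by auto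
  then have M: "add_submonoid ?C"
    using add by (auto simp: add_submonoid_def)
  show "weight_cone k a \<subseteq> ?C"
  proof
    fix p assume "p \<in> weight_cone k a"
    then obtain w t where w: "p = (sum w {1..2 * k}, edge_combination k w, t)"
        "\<forall>i\<in>{1..2 * k}. 0 \<le> w i" "of_int a * w 1 \<le> t" "t \<le> of_int a * w 1 + sum w {1..2 * k}"
      unfolding weight_cone_def by auto
    define h where "h = sum w {1..2 * k}"
    have "h \<ge> 0" unfolding h_def using w by (intro sum_nonneg) auto
    \<comment> \<open>If \<open>h = 0\<close> the quotient is \<open>0\<close>, which is right because then \<open>t = a w\<^sub>1\<close>.\<close>
    define e where "e = (t - of_int a * w 1) / h"
    have e: "e \<in> {0..1}" "of_int a * w 1 + e * h = t"
    proof -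
      have r: "0 \<le> h" "0 \<le> t - of_int a * w 1" "t - of_int a * w 1 \<le> h"
        using w(3,4) \<open>h \<ge> 0\<close> by (simp_all add: h_def)
      show "e \<in> {0..1}"
        using r by (cases "h = 0") (simp_all add: e_def pos_divide_le_eq)
      show "of_int a * w 1 + e * h = t"
        using r by (cases "h = 0") (simp_all add: e_def)
    qed
    have "(\<Sum>i\<in>{1..2 * k}. w i *\<^sub>R prism_point k a i e) \<in> ?C"
      using w(2) prism_point_in_prism[OF assms _ e(1)] sub
      by (intro add_submonoid_sum[OF M] scale) (auto simp del: atLeastAtMost_iff)
    moreover have "(\<Sum>i\<in>{1..2 * k}. w i *\<^sub>R prism_point k a i e)
        = (h, edge_combination k w, of_int a * w 1 + e * h)"
    proof -
      have "(\<Sum>i\<in>{1..2 * k}. w i * ((if i = 1 then of_int a else 0) + e))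
        = (\<Sum>i\<in>{1..2 * k}. (if i = 1 then of_int a * w 1 else 0) + e * w i)"
        by (intro sum.cong) (auto simp: algebra_simps)
      also have "\<dots> = of_int a * w 1 + e * h"
        using assms by (simp add: sum.distrib h_def sum_distrib_left)
      finally show ?thesis
        by (intro prod_eqI)
          (simp_all add: fst_sum snd_sum prism_point_def h_def edge_combination_def)
    qed
    ultimately show "p \<in> ?C"
      using e(2) w(1) h_def by simp
  qed
qed

lemma other_edge_leaves:
  assumes "k \<ge> 2" and "e \<in> {1..2 * k}" and "i \<in> {1..2 * k}" and "i \<noteq> e"
  shows "\<exists>v\<in>{1..2 * k}. v \<in> cycle_edge k i \<and> v \<notin> cycle_edge k e"
proof -
  define n where "n = (if i = 2 * k then 1 else i + 1)"
  have "i \<notin> cycle_edge k e \<or> n \<notin> cycle_edge k e"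
    using assms by (auto simp: n_def cycle_edge_def split: if_splits)
  moreover have "n \<in> {1..2 * k}" "cycle_edge k i = {i, n}"
    using assms(3) by (auto simp: n_def cycle_edge_def)
  ultimately show ?thesis
    using assms(3) by blast
qed

text \<open>All the given generators are vertices. Suppose that one of them, over the edge \<open>j\<close>, lies inside a
  segment in the polytope. Every other edge has an endpoint outside \<open>j\<close>, where the coordinate is
  \<open>0\<close>, so both ends of the segment have weight zero on every other edge. Thus they lie on the
  vertical segment over \<open>j\<close>, and the generator is one of the two endpoints of that segment.\<close>

lemma set_B_eq:
  assumes "k \<ge> 2"
  shows "set_B k a = (\<lambda>(i, e). prism_point k a i e) ` ({1..2 * k} \<times> {0, 1})"
proof
  show "set_B k a \<subseteq> (\<lambda>(i, e). prism_point k a i e) ` ({1..2 * k} \<times> {0, 1})"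
    using assms prism_hull[of k a] extreme_point_of_convex_hull unfolding set_B_def by fastforce
next
  have k1: "k \<ge> 1" using assms by simp
  have "prism_point k a j e extreme_point_of {1} \<times> polytope_P k a"
    if j: "j \<in> {1..2 * k}" and e: "e \<in> {0, 1}" for j e
    unfolding extreme_point_of_def
  proof (intro conjI ballI notI)
    show "prism_point k a j e \<in> {1} \<times> polytope_P k a"
      using j e by (intro prism_point_in_prism[OF k1]) auto
  next
    fix p q assume pq: "p \<in> {1} \<times> polytope_P k a" "q \<in> {1} \<times> polytope_P k a"
      and seg: "prism_point k a j e \<in> open_segment p q"
    obtain w t where w: "p = (sum w {1..2 * k}, edge_combination k w, t)"
        "\<forall>i\<in>{1..2 * k}. 0 \<le> w i" "of_int a * w 1 \<le> t" "t \<le> of_int a * w 1 + sum w {1..2 * k}"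
      using pq(1) prism_subset_weight_cone[OF k1, of a] unfolding weight_cone_def by blast
    obtain w' t' where w': "q = (sum w' {1..2 * k}, edge_combination k w', t')"
        "\<forall>i\<in>{1..2 * k}. 0 \<le> w' i" "of_int a * w' 1 \<le> t'" "t' \<le> of_int a * w' 1 + sum w' {1..2 * k}"
      using pq(2) prism_subset_weight_cone[OF k1, of a] unfolding weight_cone_def by blast
    have h: "sum w {1..2 * k} = 1" "sum w' {1..2 * k} = 1"
      using pq w(1) w'(1) by auto
    obtain u where u: "0 < u" "u < 1" "prism_point k a j e = (1 - u) *\<^sub>R p + u *\<^sub>R q" "p \<noteq> q"
      using seg unfolding in_segment by auto
    have x: "ind_vec (cycle_edge k j) = (1 - u) *\<^sub>R edge_combination k w + u *\<^sub>R edge_combination k w'"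
      and t: "(if j = 1 then of_int a else 0) + e = (1 - u) * t + u * t'"
      using u(3) by (auto simp: prism_point_def w(1) w'(1))
    have vanish: "w i = 0 \<and> w' i = 0" if i: "i \<in> {1..2 * k}" "i \<noteq> j" for i
    proof -
      obtain v where v: "v \<in> {1..2 * k}" "v \<in> cycle_edge k i" "v \<notin> cycle_edge k j"
        using other_edge_leaves[OF assms j i] by auto
      let ?p = "if v = 1 then 2 * k else v - 1"
      have p: "?p \<in> {1..2 * k}" using v(1) by auto
      have nn: "0 \<le> w v" "0 \<le> w ?p" "0 \<le> w' v" "0 \<le> w' ?p"
        using w(2) w'(2) v(1) p by blast+
      have "(1 - u) * (w v + w ?p) + u * (w' v + w' ?p) = 0"
        using arg_cong[OF x, of "\<lambda>y. Poly_Mapping.lookup y v"] v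
        by (simp add: lookup_add lookup_scaleR lookup_edge_combination lookup_ind_vec cycle_edge_def
            del: atLeastAtMost_iff)
      moreover have "0 \<le> (1 - u) * (w v + w ?p)" "0 \<le> u * (w' v + w' ?p)"
        using nn u by (auto intro!: mult_nonneg_nonneg add_nonneg_nonneg simp del: atLeastAtMost_iff)
      ultimately have "(1 - u) * (w v + w ?p) = 0" "u * (w' v + w' ?p) = 0"
        by linarith+
      then have "w v + w ?p = 0" "w' v + w' ?p = 0"
        using u by auto
      then have "w v = 0 \<and> w' v = 0" "w ?p = 0 \<and> w' ?p = 0"
        using nn by linarith+
      moreover have "i = v \<or> i = ?p"
        using v i by (auto simp: cycle_edge_def split: if_splits)
      ultimately show ?thesis by blast
    qed
    have "sum w {1..2 * k} = w j" "sum w' {1..2 * k} = w' j"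
      using j vanish by (subst sum.remove[of _ j]; auto)+
    then have wj: "w j = 1" "w' j = 1" using h by auto
    have c: "edge_combination k w = edge_combination k w'"
      using vanish wj by (intro edge_combination_cong) metis
    have w1: "w 1 = (if j = 1 then 1 else 0)" "w' 1 = (if j = 1 then 1 else 0)"
      using vanish[of 1] wj k1 by auto
    define r where "r = t - of_int a * w 1"
    define r' where "r' = t' - of_int a * w 1"
    have r: "r \<in> {0..1}" "r' \<in> {0..1}"
      using w w' h w1 unfolding r_def r'_def by auto
    have er: "e = (1 - u) * r + u * r'"
      using t w1 unfolding r_def r'_def by (auto simp: algebra_simps)
    have "r = r'"
    proof (cases "e = 0")
      case True
      have "0 \<le> (1 - u) * r" "0 \<le> u * r'" using u r by auto
      with er True have "(1 - u) * r = 0" "u * r' = 0" by linarith+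
      with u show ?thesis by simp
    next
      case False
      then have "(1 - u) * (1 - r) + u * (1 - r') = 0"
        using er e by (simp add: algebra_simps)
      moreover have "0 \<le> (1 - u) * (1 - r)" "0 \<le> u * (1 - r')" using u r by auto
      ultimately have "(1 - u) * (1 - r) = 0" "u * (1 - r') = 0" by linarith+
      with u show ?thesis by simp
    qed
    then have "p = q"
      using c h w(1) w'(1) r_def r'_def by simp
    with u(4) show False by simp
  qed
  then show "(\<lambda>(i, e). prism_point k a i e) ` ({1..2 * k} \<times> {0, 1}) \<subseteq> set_B k a"
    unfolding set_B_def by auto
qed

lemma prism_point_in_set_B:
  assumes "k \<ge> 2" and "i \<in> {1..2 * k}" and "e \<in> {0, 1}"
  shows "prism_point k a i e \<in> set_B k a"
  unfolding set_B_eq[OF assms(1)] using assms(2,3) by (intro image_eqI[of _ _ "(i, e)"]) auto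

section \<open>The semigroup and its generators\<close>

lemma semigroup_C_eq:
  assumes "k \<ge> 1"
  shows "semigroup_C k a = weight_cone k a \<inter> lattice_points k"
  unfolding semigroup_C_def cone_hull_prism[OF assms] ..

lemma add_submonoid_semigroup_C:
  assumes "k \<ge> 1"
  shows "add_submonoid (semigroup_C k a)"
proof -
  have "0 \<in> weight_cone k a"
    unfolding weight_cone_def mem_Collect_eq
    by (intro exI[of _ "\<lambda>_. 0"] exI[of _ 0]) (auto simp: edge_combination_def zero_prod_def)
  moreover have "x + y \<in> weight_cone k a" if "x \<in> weight_cone k a" "y \<in> weight_cone k a" for x y
    using convex_cone_weight_cone[of k a] that unfolding convex_cone by blast
  moreover have "0 \<in> lattice_points k"
    by (auto simp: lattice_points_def zero_prod_def)
  moreover have "x + y \<in> lattice_points k" if "x \<in> lattice_points k" "y \<in> lattice_points k" for x y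
    using that order_trans[OF Poly_Mapping.keys_add, of "fst (snd x)" "fst (snd y)" "{1..2 * k}"]
    by (cases x; cases y) (simp add: lattice_points_def lookup_add)
  ultimately show ?thesis
    unfolding semigroup_C_eq[OF assms] add_submonoid_def by blast
qed

lemma semigroup_C_cases:
  assumes "k \<ge> 1" and "p \<in> semigroup_C k a"
  obtains h w t where "p = (real h, edge_combination k w, of_int t)" "sum w {1..2 * k} = real h"
    "\<forall>i\<in>{1..2 * k}. 0 \<le> w i"
    "of_int a * w 1 \<le> of_int t" "of_int t \<le> of_int a * w 1 + real h"
    "\<forall>v. Poly_Mapping.lookup (edge_combination k w) v \<in> \<int>"
proof -
  obtain w s where w: "p = (sum w {1..2 * k}, edge_combination k w, s)"
      "\<forall>i\<in>{1..2 * k}. 0 \<le> w i" "of_int a * w 1 \<le> s" "s \<le> of_int a * w 1 + sum w {1..2 * k}"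
    using assms unfolding semigroup_C_eq[OF assms(1)] weight_cone_def by blast
  have L: "sum w {1..2 * k} \<in> \<int>" "s \<in> \<int>" "\<forall>v. Poly_Mapping.lookup (edge_combination k w) v \<in> \<int>"
  proof -
    have "(sum w {1..2 * k}, edge_combination k w, s) \<in> lattice_points k"
      using assms(2) unfolding semigroup_C_eq[OF assms(1)] w(1)[symmetric] by (rule IntD2)
    then show "sum w {1..2 * k} \<in> \<int>" "s \<in> \<int>" "\<forall>v. Poly_Mapping.lookup (edge_combination k w) v \<in> \<int>"
      unfolding lattice_points_def mem_Collect_eq case_prod_conv by simp_all
  qed
  have "sum w {1..2 * k} \<ge> 0" using w by (intro sum_nonneg) auto
  with L(1) obtain h :: nat where h: "sum w {1..2 * k} = real h"
    by (metis Ints_cases of_int_0_le_iff nonneg_int_cases of_int_of_nat_eq)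
  obtain t where "s = of_int t" using L(2) by (auto elim: Ints_cases)
  with w L h show ?thesis by (intro that[of h w t]) auto
qed

lemma prism_point_in_semigroup_C:
  assumes "k \<ge> 1" and "i \<in> {1..2 * k}" and "e \<in> {0, 1}"
  shows "prism_point k a i e \<in> semigroup_C k a"
proof -
  have "Poly_Mapping.keys (ind_vec (cycle_edge k i)) \<subseteq> {1..2 * k}"
    using assms(2) by (auto simp: in_keys_iff lookup_ind_vec cycle_edge_def split: if_splits)
  then have "prism_point k a i e \<in> lattice_points k"
    using assms(3) by (auto simp: lattice_points_def prism_point_def lookup_ind_vec cycle_edge_def)
  moreover have "prism_point k a i e \<in> weight_cone k a"
    using assms by (intro prism_point_in_weight_cone) auto
  ultimately show ?thesis
    unfolding semigroup_C_eq[OF assms(1)] by blast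
qed

lemma set_A_subset_semigroup_C:
  assumes "k \<ge> 1"
  shows "set_A k a \<subseteq> semigroup_C k a"
proof
  fix p assume "p \<in> set_A k a"
  then obtain t where t: "p = (real k, ind_vec {1..2 * k}, of_int t)" "int k + 1 \<le> t" "t \<le> a - 1"
    unfolding set_A_def by auto
  \<comment> \<open>With weight \<open>t / a\<close> on the odd edges the interval of last coordinates starts exactly at \<open>t\<close>.\<close>
  let ?s = "real_of_int t / real_of_int a"
  have s: "0 \<le> ?s" "?s \<le> 1" "real_of_int a * ?s = real_of_int t"
    using t by (auto simp: divide_simps)
  have "p \<in> weight_cone k a"
    unfolding weight_cone_def mem_Collect_eq using s t(1)
    by (intro exI[of _ "alternating ?s"] exI[of _ "real_of_int t"])
      (simp_all add: sum_alternating[unfolded One_nat_def] edge_combination_alternating alternating_def[of _ 1]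
        alternating_def[of _ "Suc 0"], simp add: alternating_def)
  moreover have "p \<in> lattice_points k"
    by (auto simp: lattice_points_def t(1) lookup_ind_vec in_keys_iff split: if_splits)
  ultimately show "p \<in> semigroup_C k a"
    unfolding semigroup_C_eq[OF assms] by blast
qed

text \<open>The excess of \<open>t\<close> over its lower bound is an integer between \<open>0\<close> and the number of edges counted
  with weight. It is distributed by letting each edge contribute \<open>0\<close> or \<open>1\<close>, that is, by choosing
  the lower or the upper vertex over it. The vertices only enter through membership in a
  submonoid, so the result serves for any set that generates them.\<close>

lemma integral_weights_generated:
  assumes "k \<ge> 1" and M: "add_submonoid M"
    and V: "\<And>i e. i \<in> {1..2 * k} \<Longrightarrow> e \<in> {0, 1} \<Longrightarrow> prism_point k a i e \<in> M"
    and "a * int (n 1) \<le> t" and "t \<le> a * int (n 1) + int (sum n {1..2 * k})"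
  shows "(real (sum n {1..2 * k}), edge_combination k (\<lambda>i. real (n i)), of_int t) \<in> M"
  using assms(4,5)
proof (induction "sum n {1..2 * k}" arbitrary: n t)
  case 0
  then have n: "n i = 0" if "i \<in> {1..2 * k}" for i
    using that by (metis finite_atLeastAtMost sum_eq_0_iff)
  have "t = 0" using 0 n[of 1] \<open>k \<ge> 1\<close> by auto
  moreover have "edge_combination k (\<lambda>i. real (n i)) = 0"
    using n by (simp add: edge_combination_def del: atLeastAtMost_iff)
  moreover have "0 \<in> M" using M by (simp add: add_submonoid_def)
  ultimately show ?case using 0(1) by (simp add: zero_prod_def)
next
  case (Suc h)
  then obtain j where j: "j \<in> {1..2 * k}" "n j > 0"
    by (metis Zero_not_Suc gr0I sum.neutral)
  define m where "m = n(j := n j - 1)"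
  have nm: "real (n i) = real (m i) + (if i = j then 1 else 0)" for i
    using j(2) by (auto simp: m_def)
  have "sum n {1..2 * k} = n j + sum n ({1..2 * k} - {j})"
    "sum m {1..2 * k} = m j + sum m ({1..2 * k} - {j})"
    using j by (simp_all add: sum.remove)
  moreover have "sum m ({1..2 * k} - {j}) = sum n ({1..2 * k} - {j})"
    by (intro sum.cong) (auto simp: m_def)
  ultimately have h: "h = sum m {1..2 * k}"
    using Suc.hyps(2) j(2) by (simp add: m_def)
  have sum_n: "int (sum n {1..2 * k}) = int (sum m {1..2 * k}) + 1"
    using h Suc.hyps(2) by linarith
  \<comment> \<open>The removed edge takes one unit of the excess as long as there is any.\<close>
  define e :: int where "e = (if t = a * int (n 1) then 0 else 1)"
  define s where "s = t - (if j = 1 then a else 0) - e"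
  have n1: "a * int (n 1) = a * int (m 1) + (if j = 1 then a else 0)"
    using j(2) by (auto simp: m_def algebra_simps)
  have "(real (sum m {1..2 * k}), edge_combination k (\<lambda>i. real (m i)), of_int s) \<in> M"
    using Suc.prems sum_n n1 by (intro Suc.hyps(1) h) (auto simp: s_def e_def simp del: of_nat_sum)
  moreover have "prism_point k a j (of_int e) \<in> M"
    by (intro V j) (auto simp: e_def)
  ultimately have "(real (sum m {1..2 * k}), edge_combination k (\<lambda>i. real (m i)), of_int s)
      + prism_point k a j (of_int e) \<in> M"
    using M unfolding add_submonoid_def by blast
  moreover have "edge_combination k (\<lambda>i. real (n i))
      = edge_combination k (\<lambda>i. real (m i)) + ind_vec (cycle_edge k j)"
    unfolding nm edge_combination_add edge_combination_single[OF j(1)] by simp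
  moreover have "real (sum n {1..2 * k}) = real (sum m {1..2 * k}) + 1"
    using sum_n by linarith
  ultimately show ?case
    by (cases "j = 1") (simp_all add: prism_point_def s_def del: of_nat_sum)
qed

text \<open>The two matchings cover the last coordinates from \<open>0\<close> to \<open>k\<close> and from \<open>a\<close> to \<open>a + k\<close>. The set
  \<open>A\<close> consists exactly of the points in the gap between these ranges.\<close>

lemma all_ones_generated:
  assumes "k \<ge> 1" and M: "add_submonoid M"
    and V: "\<And>i e. i \<in> {1..2 * k} \<Longrightarrow> e \<in> {0, 1} \<Longrightarrow> prism_point k a i e \<in> M"
    and A: "set_A k a \<subseteq> M"
    and t: "0 \<le> t" "t \<le> a + int k"
  shows "(real k, ind_vec {1..2 * k}, of_int t) \<in> M"
proof -
  have alt: "(real k, ind_vec {1..2 * k}, of_int t) \<in> M"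
    if c: "c \<in> {0, 1}" "a * int c \<le> t" "t \<le> a * int c + int k" for c :: nat
  proof -
    define n where "n i = (if odd i then c else 1 - c)" for i :: nat
    have n: "(\<lambda>i. real (n i)) = alternating (real c)"
      using c(1) by (auto simp: n_def alternating_def)
    have "real (sum n {1..2 * k}) = real k"
      using sum_alternating[of "real c" k] by (simp flip: n)
    then have s: "sum n {1..2 * k} = k" by linarith
    have "(real (sum n {1..2 * k}), edge_combination k (\<lambda>i. real (n i)), of_int t) \<in> M"
      using c(2,3) by (intro integral_weights_generated[OF assms(1) M V]) (simp_all add: s[unfolded One_nat_def], simp_all add: n_def)
    then show ?thesis
      by (simp only: n s edge_combination_alternating)
  qed
  consider "t \<le> int k" | "a \<le> t" | "int k + 1 \<le> t" "t \<le> a - 1" by linarith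
  then show ?thesis
  proof cases
    case 1
    then show ?thesis using alt[of 0] t by simp
  next
    case 2
    then show ?thesis using alt[of 1] t by simp
  next
    case 3
    then show ?thesis using A unfolding set_A_def by blast
  qed
qed

text \<open>In the non-integral case the interval of the floor weights, extended by the interval from \<open>0\<close> to
  \<open>a + k\<close> that is available for the all-ones part, covers the whole interval of the given weights.\<close>

lemma semigroup_C_generated:
  assumes "k \<ge> 1" and "a \<ge> 0" and M: "add_submonoid M"
    and V: "\<And>i e. i \<in> {1..2 * k} \<Longrightarrow> e \<in> {0, 1} \<Longrightarrow> prism_point k a i e \<in> M"
    and A: "set_A k a \<subseteq> M"
  shows "semigroup_C k a \<subseteq> M"
proof
  fix p assume "p \<in> semigroup_C k a"
  then obtain h w t where p: "p = (real h, edge_combination k w, of_int t)"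
    and h: "sum w {1..2 * k} = real h"
    and nn: "\<forall>i\<in>{1..2 * k}. 0 \<le> w i"
    and t: "of_int a * w 1 \<le> of_int t" "of_int t \<le> of_int a * w 1 + real h"
    and int: "\<forall>v. Poly_Mapping.lookup (edge_combination k w) v \<in> \<int>"
    by (rule semigroup_C_cases[OF assms(1)])
  define n where "n i = nat \<lfloor>w i\<rfloor>" for i
  have n: "of_int \<lfloor>w i\<rfloor> = real (n i)" if "i \<in> {1..2 * k}" for i
    using bspec[OF nn that] by (simp add: n_def)
  have one: "1 \<in> {1..2 * k}" using assms(1) by simp
  show "p \<in> M"
  proof (cases "w 1 \<in> \<int>")
    case True
    have w: "w i = real (n i)" if "i \<in> {1..2 * k}" for i
      using weights_integral[OF int[rule_format] True that] n[OF that] by (auto elim!: Ints_cases)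
    have c: "edge_combination k w = edge_combination k (\<lambda>i. real (n i))"
      by (intro edge_combination_cong w)
    have "sum w {1..2 * k} = (\<Sum>i\<in>{1..2 * k}. real (n i))"
      by (intro sum.cong refl w)
    then have "real h = real (sum n {1..2 * k})" unfolding h of_nat_sum .
    then have s: "h = sum n {1..2 * k}" by (simp only: of_nat_eq_iff)
    have "real_of_int (a * int (n 1)) \<le> of_int t" "real_of_int t \<le> of_int (a * int (n 1) + int h)"
      using t w[OF one] by simp_all
    then have "a * int (n 1) \<le> t" "t \<le> a * int (n 1) + int h"
      by (simp_all only: of_int_le_iff)
    then show ?thesis
      unfolding p c s by (intro integral_weights_generated[OF assms(1) M V]) auto
  next
    case False
    note dec = weights_floor_plus_alternating[OF int[rule_format] False]
    have c: "edge_combination k w = edge_combination k (\<lambda>i. real (n i)) + ind_vec {1..2 * k}"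
      using dec(2) edge_combination_cong[OF n, of k] by simp
    define H where "H = sum n {1..2 * k}"
    have "(\<Sum>i\<in>{1..2 * k}. of_int \<lfloor>w i\<rfloor>) = real H"
      unfolding H_def of_nat_sum by (intro sum.cong refl n)
    then have hH: "h = H + k" using dec(1) h by simp
    have "real (n 1) \<le> w 1" "w 1 \<le> real (n 1) + 1"
      using n[OF one] by linarith+
    then have "of_int a * real (n 1) \<le> of_int a * w 1" "of_int a * w 1 \<le> of_int a * (real (n 1) + 1)"
      using \<open>a \<ge> 0\<close> by (auto intro!: mult_left_mono)
    then have "real_of_int (a * int (n 1)) \<le> of_int t"
      "real_of_int t \<le> of_int (a * int (n 1) + a + int H + int k)"
      using t hH by (simp_all add: algebra_simps)
    then have tb: "a * int (n 1) \<le> t" "t \<le> a * int (n 1) + a + int H + int k"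
      by (simp_all only: of_int_le_iff)
    \<comment> \<open>The floor part takes as much of \<open>t\<close> as its own interval admits.\<close>
    define r where "r = min t (a * int (n 1) + int H)"
    have "(real H, edge_combination k (\<lambda>i. real (n i)), of_int r) \<in> M"
      unfolding H_def using tb
      by (intro integral_weights_generated[OF assms(1) M V]) (auto simp: r_def H_def simp del: of_nat_sum)
    moreover have "(real k, ind_vec {1..2 * k}, of_int (t - r)) \<in> M"
      using tb \<open>a \<ge> 0\<close> by (intro all_ones_generated[OF assms(1) M V A]) (auto simp: r_def)
    ultimately have "(real H, edge_combination k (\<lambda>i. real (n i)), of_int r)
        + (real k, ind_vec {1..2 * k}, of_int (t - r)) \<in> M"
      using M unfolding add_submonoid_def by blast
    then show ?thesis
      by (simp add: p c hH)
  qed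
qed

section \<open>Irreducibility of the generators\<close>

lemma height_zero_imp_zero:
  assumes "k \<ge> 1" and "p \<in> semigroup_C k a" and "fst p = 0"
  shows "p = 0"
proof -
  obtain h w t where p: "p = (real h, edge_combination k w, of_int t)"
    and h: "sum w {1..2 * k} = real h"
    and nn: "\<forall>i\<in>{1..2 * k}. 0 \<le> w i"
    and t: "of_int a * w 1 \<le> of_int t" "of_int t \<le> of_int a * w 1 + real h"
    and "\<forall>v. Poly_Mapping.lookup (edge_combination k w) v \<in> \<int>"
    by (rule semigroup_C_cases[OF assms(1,2)])
  have "h = 0" using p assms(3) by simp
  then have "w i = 0" if "i \<in> {1..2 * k}" for i
    using h nn that by (simp add: sum_nonneg_eq_0_iff del: atLeastAtMost_iff)
  then have "edge_combination k w = 0" "w 1 = 0"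
    using assms(1) by (auto simp: edge_combination_def intro!: sum.neutral)
  then show ?thesis
    using t p \<open>h = 0\<close> by (simp add: zero_prod_def)
qed

lemma prism_point_irreducible:
  assumes "k \<ge> 1" and "x \<in> semigroup_C k a" and "y \<in> semigroup_C k a"
    and "x + y = prism_point k a i e"
  shows "x = 0 \<or> y = 0"
proof -
  obtain h where h: "fst x = real h"
    by (metis semigroup_C_cases[OF assms(1,2)] fst_conv)
  obtain h' where h': "fst y = real h'"
    by (metis semigroup_C_cases[OF assms(1,3)] fst_conv)
  have "real h + real h' = 1"
    using arg_cong[OF assms(4), of fst] h h' by (simp add: prism_point_def)
  then have "h = 0 \<or> h' = 0" by linarith
  then show ?thesis
    using height_zero_imp_zero[OF assms(1,2)] height_zero_imp_zero[OF assms(1,3)] h h' by auto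
qed

text \<open>The heights of two nonzero summands are positive and add up to \<open>k\<close>, so neither reaches \<open>k\<close>. Hence
  no summand can have alternating fractional parts, and the first edge has integral weight in both.
  The coordinate at vertex \<open>1\<close> bounds the sum of these two weights by \<open>1\<close>, which forces the last
  coordinate into the range of one of the two matchings.\<close>

lemma set_A_irreducible:
  assumes "k \<ge> 1" and "x \<in> semigroup_C k a" and "y \<in> semigroup_C k a"
    and "x + y \<in> set_A k a"
  shows "x = 0 \<or> y = 0"
proof (rule ccontr)
  assume "\<not> (x = 0 \<or> y = 0)"
  then have nz: "x \<noteq> 0" "y \<noteq> 0" by auto
  have one: "1 \<in> {1..2 * k}" using assms(1) by simp
  obtain s where s: "x + y = (real k, ind_vec {1..2 * k}, of_int s)" "int k + 1 \<le> s" "s \<le> a - 1"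
    using assms(4) unfolding set_A_def by auto
  obtain h w t where x: "x = (real h, edge_combination k w, of_int t)"
    and h: "sum w {1..2 * k} = real h"
    and nn: "\<forall>i\<in>{1..2 * k}. 0 \<le> w i"
    and t: "of_int a * w 1 \<le> of_int t" "of_int t \<le> of_int a * w 1 + real h"
    and int: "\<forall>v. Poly_Mapping.lookup (edge_combination k w) v \<in> \<int>"
    by (rule semigroup_C_cases[OF assms(1,2)])
  obtain h' w' t' where y: "y = (real h', edge_combination k w', of_int t')"
    and h': "sum w' {1..2 * k} = real h'"
    and nn': "\<forall>i\<in>{1..2 * k}. 0 \<le> w' i"
    and t': "of_int a * w' 1 \<le> of_int t'" "of_int t' \<le> of_int a * w' 1 + real h'"
    and int': "\<forall>v. Poly_Mapping.lookup (edge_combination k w') v \<in> \<int>"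
    by (rule semigroup_C_cases[OF assms(1,3)])
  have "fst x \<noteq> 0" "fst y \<noteq> 0"
    using height_zero_imp_zero[OF assms(1,2)] height_zero_imp_zero[OF assms(1,3)] nz by blast+
  then have "h > 0" "h' > 0"
    unfolding x y by simp_all
  moreover have "real h + real h' = real k" using s(1) x y by simp
  then have hk: "h + h' = k" by linarith
  ultimately have lt: "h < k" "h' < k" by auto
  have low: "u 1 \<in> \<int>" if "sum u {1..2 * k} < real k" "\<And>i. i \<in> {1..2 * k} \<Longrightarrow> 0 \<le> u i"
    "\<And>v. Poly_Mapping.lookup (edge_combination k u) v \<in> \<int>" for u
  proof (rule ccontr)
    assume "u 1 \<notin> \<int>"
    from weights_floor_plus_alternating(1)[OF that(3) this]
    have "(\<Sum>i\<in>{1..2 * k}. real_of_int \<lfloor>u i\<rfloor>) < 0" using that(1) by simp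
    moreover have "(\<Sum>i\<in>{1..2 * k}. real_of_int \<lfloor>u i\<rfloor>) \<ge> 0"
      using that(2) by (intro sum_nonneg) auto
    ultimately show False by simp
  qed
  have "w 1 \<in> \<int>" "w' 1 \<in> \<int>"
    using low[of w] low[of w'] nn nn' int int' h h' lt by auto
  then obtain c where c: "w 1 + w' 1 = of_int c"
    by (meson Ints_add Ints_cases)
  have "edge_combination k w + edge_combination k w' = ind_vec {1..2 * k}"
    using s(1) x y by simp
  from arg_cong[OF this, of "\<lambda>z. Poly_Mapping.lookup z 1"]
  have "w 1 + w (2 * k) + (w' 1 + w' (2 * k)) = 1"
    using one by (simp add: lookup_add lookup_edge_combination lookup_ind_vec)
  moreover have "0 \<le> w (2 * k)" "0 \<le> w' (2 * k)" "0 \<le> w 1" "0 \<le> w' 1"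
    using nn nn' assms(1) by auto
  ultimately have "c = 0 \<or> c = 1" using c by linarith
  moreover have "of_int a * (w 1 + w' 1) \<le> of_int s" "of_int s \<le> of_int a * (w 1 + w' 1) + real k"
    using t t' s(1) x y hk by (auto simp: distrib_left)
  ultimately show False
    using c s(2,3) by auto
qed

theorem theorem9:
  fixes k :: nat and a :: int
  assumes "k \<ge> 2" and "a \<ge> 0"
  shows "is_hilbert_basis (semigroup_C k a) (set_B k a \<union> set_A k a)"
  unfolding is_hilbert_basis_def
proof (intro conjI allI impI)
  have k1: "k \<ge> 1" using assms(1) by simp
  let ?H = "set_B k a \<union> set_A k a"
  have sub: "?H \<subseteq> semigroup_C k a"
    using set_A_subset_semigroup_C[OF k1] prism_point_in_semigroup_C[OF k1]
    unfolding set_B_eq[OF assms(1)] by auto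
  show "add_submonoid hull ?H = semigroup_C k a"
  proof
    show "add_submonoid hull ?H \<subseteq> semigroup_C k a"
      using sub add_submonoid_semigroup_C[OF k1] by (rule hull_minimal)
    have "?H \<subseteq> add_submonoid hull ?H" by (rule hull_subset)
    then show "semigroup_C k a \<subseteq> add_submonoid hull ?H"
      using prism_point_in_set_B[OF assms(1)]
      by (intro semigroup_C_generated[OF k1 assms(2) add_submonoid_hull]) blast+
  qed
  fix G assume G: "add_submonoid hull G = semigroup_C k a"
  show "?H \<subseteq> G"
  proof
    fix p assume p: "p \<in> ?H"
    have "fst p \<noteq> 0"
      using p k1 unfolding set_B_eq[OF assms(1)] by (auto simp: prism_point_def set_A_def)
    then have "p \<noteq> 0" by auto
    show "p \<in> G"
    proof (rule irreducible_in_generating_set[OF G _ \<open>p \<noteq> 0\<close>])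
      show "p \<in> semigroup_C k a" using p sub by auto
      show "x = 0 \<or> y = 0" if "x \<in> semigroup_C k a" "y \<in> semigroup_C k a" "x + y = p" for x y
        using p that prism_point_irreducible[OF k1 that(1,2)] set_A_irreducible[OF k1 that(1,2)]
        unfolding set_B_eq[OF assms(1)] by auto
    qed
  qed
qed

end
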